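(* Let $V$ be a valuation domain with quotient field $K$ and valuation $v$. Let $E=\{s_\nu\}_{\nu\in\Lambda}\subset K$ be a pseudo-monotone sequence of gauge $\{\delta_\nu\}_{\nu\in\Lambda}$, and let $\phi\in K(X)$ be nonzero. Let $u$ be an extension of $v$ to $\overline K$ and let $\lambda=\mathrm{degdom}_{E,u}(\phi)$. Then there exist $\gamma\in\Gamma_v$ and $\nu_0\in\Lambda$ such that for each $\nu\geq\nu_0$ we have $$v(\phi(s_\nu))=\lambda\delta_\nu+\gamma.$$ Furthermore, if $\beta\in\overline K$ is a pseudo-limit of $E$ with respect to $u$, then $\gamma=u\left(\frac{\phi}{\phi_S}(\beta)\right)$, where $S$ is the multiset of critical points of $\phi$ which are pseudo-limits of $E$ with respect to $u$. Moreover, the dominating degree of $\phi$ does not depend on $u$; that is, if $u'$ is another extension of $v$ to $\overline K$, then $\mathrm{degdom}_{E,u}(\phi)=\mathrm{degdom}_{E,u'}(\phi)$.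
   Context: $\Gamma_v$ is the value group of $v$; $\overline K$ is a fixed algebraic closure of $K$. Sequences $E=\{s_\nu\}_{\nu\in\Lambda}\subset K$ are indexed by well-ordered sets $\Lambda$ without maximum. $E$ is pseudo-convergent if $v(s_\rho-s_\nu)<v(s_\sigma-s_\rho)$ for all $\nu<\rho<\sigma$; pseudo-divergent if $v(s_\rho-s_\nu)>v(s_\sigma-s_\rho)$ for all $\nu<\rho<\sigma$; pseudo-stationary if $v(s_\nu-s_\mu)=v(s_{\nu'}-s_{\mu'})$ for all $\nu\ne\mu$, $\nu'\neq\mu'$; pseudo-monotone if it is one of these three. The gauge $\{\delta_\nu\}$ of $E$ is: $\delta_\nu=v(s_\rho-s_\nu)$ for any $\rho>\nu$ if $E$ is pseudo-convergent; $\delta_\nu=v(s_\rho-s_\nu)$ for any $\rho<\nu$ ($\nu$ not the minimum of $\Lambda$) if $E$ is pseudo-divergent; the constant $\delta_\nu=v(s_\rho-s_\mu)$, $\rho\neq\mu$, if $E$ is pseudo-stationary. If $u$ is an extension of $v$ to $\overline K$, an element $\alpha\in\overline K$ is a pseudo-limit of $E$ with respect to $u$ if $u(\alpha-s_\nu)=\delta_\nu$ for all sufficiently large $\nu$. For $\phi\in K(X)$ nonzero, a critical point of $\phi$ is a zero or pole of $\phi$ in $\overline K$; $\Omega_\phi$ is the multiset of critical points (counted with multiplicity). For a submultiset $S=\{\alpha_1,\dots,\alpha_k\}$ of $\Omega_\phi$ let $\epsilon_i=1$ if $\alpha_i$ is a zero and $\epsilon_i=-1$ if $\alpha_i$ is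 a pole; the weighted sum of $S$ is $\sum_i\epsilon_i$ and the $S$-part of $\phi$ is $\phi_S(X)=\prod_{\alpha_i\in S}(X-\alpha_i)^{\epsilon_i}$. The dominating degree $\mathrm{degdom}_{E,u}(\phi)$ is the weighted sum of the submultiset of those elements of $\Omega_\phi$ which are pseudo-limits of $E$ with respect to $u$. *)

theory Defs
  imports
    "HOL-Algebra.Algebraic_Closure_Type"
    "HOL-Library.Extended"
begin

section \<open>Valuations\<close>

text \<open>
  A valuation takes values in \<open>\<Gamma> \<union> {\<infinity>}\<close>. We use the library type \<open>'g extended\<close> and forbid the
  superfluous value \<open>Minf\<close>. The type \<open>'g\<close> may be larger than the value group \<open>\<Gamma>\<^sub>v\<close>, which is the set
  of finite values that are attained.
\<close>

definition valuation :: "('a::field \<Rightarrow> 'g::linordered_ab_group_add extended) \<Rightarrow> bool" where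
  "valuation v \<longleftrightarrow>
     (\<forall>x. v x \<noteq> Minf) \<and>
     (\<forall>x. v x = Pinf \<longleftrightarrow> x = 0) \<and>
     (\<forall>x y. v (x * y) = v x + v y) \<and>
     (\<forall>x y. min (v x) (v y) \<le> v (x + y))"

definition value_group :: "('a::field \<Rightarrow> 'g::linordered_ab_group_add extended) \<Rightarrow> 'g set" where
  "value_group v = {g. \<exists>x. v x = Fin g}"

text \<open>Valuation domains whose quotient field is the whole type \<open>'a\<close>.\<close>

definition valuation_domain :: "'a::field set \<Rightarrow> bool" where
  "valuation_domain V \<longleftrightarrow>
     0 \<in> V \<and> 1 \<in> V \<and> (\<forall>x\<in>V. \<forall>y\<in>V. x - y \<in> V \<and> x * y \<in> V) \<and>
     (\<forall>x. x \<noteq> 0 \<longrightarrow> x \<in> V \<or> inverse x \<in> V)"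

definition valuation_of :: "'a::field set \<Rightarrow> ('a \<Rightarrow> 'g::linordered_ab_group_add extended) \<Rightarrow> bool" where
  "valuation_of V v \<longleftrightarrow> valuation v \<and> V = {x. 0 \<le> v x}"

text \<open>
  Two extensions of \<open>v\<close> to the algebraic closure need not come with a common value group, so the
  inclusion \<open>\<Gamma>\<^sub>v \<subseteq> \<Gamma>\<^sub>u\<close> is made explicit as an embedding \<open>j\<close> of ordered groups. Only the values of
  \<open>j\<close> on \<open>\<Gamma>\<^sub>v\<close> matter. Taking \<open>j = id\<close> gives an extension with literally the same values.
\<close>

definition extends_valuation ::
  "('g::linordered_ab_group_add \<Rightarrow> 'h::linordered_ab_group_add) \<Rightarrow> ('k::field \<Rightarrow> 'g extended) \<Rightarrow>
   ('k alg_closure \<Rightarrow> 'h extended) \<Rightarrow> bool" where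
  "extends_valuation j v u \<longleftrightarrow>
     valuation u \<and>
     (\<forall>a\<in>value_group v. \<forall>b\<in>value_group v. j (a + b) = j a + j b) \<and>
     strict_mono_on (value_group v) j \<and>
     (\<forall>x. u (to_ac x) = map_extended j (v x))"

definition int_multiple :: "int \<Rightarrow> 'g::ab_group_add \<Rightarrow> 'g" where
  "int_multiple n g = (\<Sum>i<nat n. g) - (\<Sum>i<nat (- n). g)"


section \<open>Pseudo-monotone sequences\<close>

text \<open>Index sets are types of class \<open>{wellorder, no_top}\<close>: well-ordered without maximum.\<close>

definition pseudo_convergent ::
  "('k::field \<Rightarrow> 'g::linordered_ab_group_add extended) \<Rightarrow> ('i::{wellorder, no_top} \<Rightarrow> 'k) \<Rightarrow> bool" where
  "pseudo_convergent v s \<longleftrightarrow>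
     (\<forall>\<nu> \<rho> \<sigma>. \<nu> < \<rho> \<and> \<rho> < \<sigma> \<longrightarrow> v (s \<rho> - s \<nu>) < v (s \<sigma> - s \<rho>))"

definition pseudo_divergent ::
  "('k::field \<Rightarrow> 'g::linordered_ab_group_add extended) \<Rightarrow> ('i::{wellorder, no_top} \<Rightarrow> 'k) \<Rightarrow> bool" where
  "pseudo_divergent v s \<longleftrightarrow>
     (\<forall>\<nu> \<rho> \<sigma>. \<nu> < \<rho> \<and> \<rho> < \<sigma> \<longrightarrow> v (s \<rho> - s \<nu>) > v (s \<sigma> - s \<rho>))"

text \<open>
  The common value of the differences is meant to be an element of \<open>\<Gamma>\<^sub>v\<close>. Injectivity of \<open>s\<close>
  expresses exactly this: it excludes the constant sequences, whose common value would be \<open>\<infinity>\<close>.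
\<close>

definition pseudo_stationary ::
  "('k::field \<Rightarrow> 'g::linordered_ab_group_add extended) \<Rightarrow> ('i::{wellorder, no_top} \<Rightarrow> 'k) \<Rightarrow> bool" where
  "pseudo_stationary v s \<longleftrightarrow> inj s \<and>
     (\<forall>\<nu> \<mu> \<nu>' \<mu>'. \<nu> \<noteq> \<mu> \<and> \<nu>' \<noteq> \<mu>' \<longrightarrow> v (s \<nu> - s \<mu>) = v (s \<nu>' - s \<mu>'))"

definition pseudo_monotone ::
  "('k::field \<Rightarrow> 'g::linordered_ab_group_add extended) \<Rightarrow> ('i::{wellorder, no_top} \<Rightarrow> 'k) \<Rightarrow> bool" where
  "pseudo_monotone v s \<longleftrightarrow> pseudo_convergent v s \<or> pseudo_divergent v s \<or> pseudo_stationary v s"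

text \<open>
  In the pseudo-divergent case \<open>\<delta>\<close> is arbitrary at the least index, which has no \<open>\<rho> < \<nu>\<close>.
  Nothing forbids the first two terms of a pseudo-divergent sequence to coincide, so that \<open>\<delta>\<close> may
  be \<open>\<infinity>\<close> at the second index. All other values are finite.
\<close>

definition is_gauge ::
  "('k::field \<Rightarrow> 'g::linordered_ab_group_add extended) \<Rightarrow> ('i::{wellorder, no_top} \<Rightarrow> 'k) \<Rightarrow>
   ('i \<Rightarrow> 'g extended) \<Rightarrow> bool" where
  "is_gauge v s \<delta> \<longleftrightarrow>
     (pseudo_convergent v s \<longrightarrow> (\<forall>\<nu> \<rho>. \<nu> < \<rho> \<longrightarrow> \<delta> \<nu> = v (s \<rho> - s \<nu>))) \<and>
     (pseudo_divergent v s \<longrightarrow> (\<forall>\<nu> \<rho>. \<rho> < \<nu> \<longrightarrow> \<delta> \<nu> = v (s \<rho> - s \<nu>))) \<and>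
     (pseudo_stationary v s \<longrightarrow> (\<forall>\<nu> \<rho> \<mu>. \<rho> \<noteq> \<mu> \<longrightarrow> \<delta> \<nu> = v (s \<rho> - s \<mu>)))"

definition pseudo_limit ::
  "('g::linordered_ab_group_add \<Rightarrow> 'h::linordered_ab_group_add) \<Rightarrow> ('k::field alg_closure \<Rightarrow> 'h extended) \<Rightarrow>
   ('i::{wellorder, no_top} \<Rightarrow> 'k) \<Rightarrow> ('i \<Rightarrow> 'g extended) \<Rightarrow> 'k alg_closure \<Rightarrow> bool" where
  "pseudo_limit j u s \<delta> \<alpha> \<longleftrightarrow>
     (\<exists>\<nu>\<^sub>0. \<forall>\<nu>\<ge>\<nu>\<^sub>0. u (\<alpha> - to_ac (s \<nu>)) = map_extended j (\<delta> \<nu>))"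


section \<open>Rational functions\<close>

text \<open>\<open>K(X)\<close> is \<open>'k poly fract\<close>. Lowest terms are unique only up to a common constant factor.\<close>

definition rat_quot :: "'a::field poly fract \<Rightarrow> 'a poly \<times> 'a poly" where
  "rat_quot \<phi> = (SOME (p, q). q \<noteq> 0 \<and> coprime p q \<and> \<phi> = Fract p q)"

definition rat_zeros :: "'a::field poly fract \<Rightarrow> 'a multiset" where
  "rat_zeros \<phi> = proots (fst (rat_quot \<phi>))"

definition rat_poles :: "'a::field poly fract \<Rightarrow> 'a multiset" where
  "rat_poles \<phi> = proots (snd (rat_quot \<phi>))"

text \<open>At a pole the value is \<open>0\<close>, by the convention for division by zero.\<close>

definition rat_eval :: "'a::field poly fract \<Rightarrow> 'a \<Rightarrow> 'a" where
  "rat_eval \<phi> x = poly (fst (rat_quot \<phi>)) x / poly (snd (rat_quot \<phi>)) x"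

text \<open>The inclusion of \<open>K(X)\<close> in the field of rational functions over the algebraic closure.\<close>

definition rat_to_ac :: "'k::field poly fract \<Rightarrow> 'k alg_closure poly fract" where
  "rat_to_ac \<phi> = Fract (map_poly to_ac (fst (rat_quot \<phi>))) (map_poly to_ac (snd (rat_quot \<phi>)))"

lemma rat_quot_exists:
  fixes \<phi> :: "'a::field poly fract"
  shows "\<exists>p q. q \<noteq> 0 \<and> coprime p q \<and> \<phi> = Fract p q"
proof -
  define P where "P n \<longleftrightarrow> (\<exists>p q. q \<noteq> 0 \<and> \<phi> = Fract p q \<and> degree q = n)" for n
  have "\<exists>n. P n" unfolding P_def by (rule Fract_cases[of \<phi>]) blast
  then have "P (LEAST n. P n)" by (rule LeastI_ex)
  then obtain p q where pq: "q \<noteq> 0" "\<phi> = Fract p q" "degree q = (LEAST n. P n)"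
    unfolding P_def by blast
  have "coprime p q"
  proof (rule coprimeI)
    fix c assume "c dvd p" "c dvd q"
    then obtain p' q' where c: "p = c * p'" "q = c * q'" by (auto elim!: dvdE)
    with pq(1) have nz: "c \<noteq> 0" "q' \<noteq> 0" by auto
    then have "\<phi> = Fract p' q'" using pq c by (simp add: eq_fract)
    then have "P (degree q')" using nz unfolding P_def by blast
    then have "degree q \<le> degree q'" using pq(3) by (simp add: Least_le)
    then have "degree c = 0" using c nz by (simp add: degree_mult_eq)
    then show "is_unit c" using nz by (simp add: is_unit_iff_degree)
  qed
  with pq show ?thesis by blast
qed

lemma rat_quot:
  fixes \<phi> :: "'a::field poly fract"
  shows "snd (rat_quot \<phi>) \<noteq> 0" "coprime (fst (rat_quot \<phi>)) (snd (rat_quot \<phi>))"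
    "\<phi> = Fract (fst (rat_quot \<phi>)) (snd (rat_quot \<phi>))"
proof -
  have "case rat_quot \<phi> of (p, q) \<Rightarrow> q \<noteq> 0 \<and> coprime p q \<and> \<phi> = Fract p q"
    unfolding rat_quot_def by (rule someI_ex) (use rat_quot_exists[of \<phi>] in auto)
  then show "snd (rat_quot \<phi>) \<noteq> 0" "coprime (fst (rat_quot \<phi>)) (snd (rat_quot \<phi>))"
    "\<phi> = Fract (fst (rat_quot \<phi>)) (snd (rat_quot \<phi>))"
    by (auto simp: case_prod_unfold)
qed

lemma coprime_poly_dvd_mult:
  fixes a b q :: "'a::field poly"
  assumes "coprime a b" "b \<noteq> 0" "b dvd a * q"
  shows "b dvd q"
proof -
  define I where "I = {x * a + y * b | x y. True}"
  define P where "P n \<longleftrightarrow> (\<exists>d\<in>I. d \<noteq> 0 \<and> degree d = n)" for n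
  have aI: "a \<in> I" and bI: "b \<in> I"
    unfolding I_def by (rule CollectI, rule exI[of _ 1], rule exI[of _ 0], simp)
      (rule CollectI, rule exI[of _ 0], rule exI[of _ 1], simp)
  have "\<exists>n. P n" using bI assms(2) unfolding P_def by blast
  then have "P (LEAST n. P n)" by (rule LeastI_ex)
  then obtain d where d: "d \<in> I" "d \<noteq> 0" "degree d = (LEAST n. P n)"
    unfolding P_def by blast
  have dvd: "d dvd z" if z: "z \<in> I" for z
  proof (rule ccontr)
    assume "\<not> d dvd z"
    then have nz: "z mod d \<noteq> 0" by (simp add: mod_eq_0_iff_dvd)
    obtain x y x' y' where xy: "z = x * a + y * b" "d = x' * a + y' * b"
      using z d(1) unfolding I_def by blast
    have "z mod d = z - z div d * d" by (rule minus_div_mult_eq_mod[symmetric])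
    also have "\<dots> = (x - z div d * x') * a + (y - z div d * y') * b"
      using xy by (simp add: algebra_simps)
    finally have "z mod d \<in> I" unfolding I_def by blast
    with nz have "P (degree (z mod d))" unfolding P_def by blast
    then have "degree d \<le> degree (z mod d)" using d(3) by (simp add: Least_le)
    then show False using degree_mod_less[OF d(2), of z] nz by linarith
  qed
  then have "is_unit d" using assms(1) aI bI coprime_common_divisor by blast
  moreover obtain x y where "d = x * a + y * b" using d(1) unfolding I_def by blast
  then have "d * q = x * (a * q) + b * (y * q)" by (simp add: algebra_simps)
  then have "b dvd d * q" using assms(3) by simp
  ultimately show ?thesis by (simp add: dvd_mult_unit_iff')
qed

lemma rat_eval_Fract:
  fixes p q :: "'a::field poly"
  assumes "poly q x \<noteq> 0"
  shows "rat_eval (Fract p q) x = poly p x / poly q x"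
proof -
  define a b where "a = fst (rat_quot (Fract p q))" and "b = snd (rat_quot (Fract p q))"
  have ab: "b \<noteq> 0" "coprime a b" "Fract p q = Fract a b"
    using rat_quot[of "Fract p q"] by (simp_all add: a_def b_def)
  have "q \<noteq> 0" using assms by auto
  with ab have eq: "p * b = a * q" by (simp add: eq_fract)
  then have "b dvd a * q" by (metis dvd_triv_right)
  then have "b dvd q" using ab(1,2) coprime_poly_dvd_mult by blast
  then have "poly b x \<noteq> 0" using assms by (auto elim!: dvdE)
  moreover have "poly p x * poly b x = poly a x * poly q x" using eq by (metis poly_mult)
  ultimately show ?thesis
    using assms by (simp add: rat_eval_def flip: a_def b_def) (simp add: frac_eq_eq)
qed

definition critical_points :: "'k::field poly fract \<Rightarrow> 'k alg_closure multiset" where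
  "critical_points \<phi> = rat_zeros (rat_to_ac \<phi>) + rat_poles (rat_to_ac \<phi>)"

text \<open>Only meaningful for critical points, which are either zeros or poles but never both.\<close>

definition crit_sign :: "'k::field poly fract \<Rightarrow> 'k alg_closure \<Rightarrow> int" where
  "crit_sign \<phi> \<alpha> = (if \<alpha> \<in># rat_zeros (rat_to_ac \<phi>) then 1 else - 1)"

definition weighted_sum :: "'k::field poly fract \<Rightarrow> 'k alg_closure multiset \<Rightarrow> int" where
  "weighted_sum \<phi> S = (\<Sum>\<alpha>\<in>#S. crit_sign \<phi> \<alpha>)"

definition S_part :: "'k::field poly fract \<Rightarrow> 'k alg_closure multiset \<Rightarrow> 'k alg_closure poly fract" where
  "S_part \<phi> S = (\<Prod>\<alpha>\<in>#S. Fract [:- \<alpha>, 1:] 1 powi crit_sign \<phi> \<alpha>)"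

definition limit_critical_points ::
  "('g::linordered_ab_group_add \<Rightarrow> 'h::linordered_ab_group_add) \<Rightarrow> ('k::field alg_closure \<Rightarrow> 'h extended) \<Rightarrow>
   ('i::{wellorder, no_top} \<Rightarrow> 'k) \<Rightarrow> ('i \<Rightarrow> 'g extended) \<Rightarrow> 'k poly fract \<Rightarrow> 'k alg_closure multiset" where
  "limit_critical_points j u s \<delta> \<phi> = {#\<alpha> \<in># critical_points \<phi>. pseudo_limit j u s \<delta> \<alpha>#}"

definition degdom ::
  "('g::linordered_ab_group_add \<Rightarrow> 'h::linordered_ab_group_add) \<Rightarrow> ('k::field alg_closure \<Rightarrow> 'h extended) \<Rightarrow>
   ('i::{wellorder, no_top} \<Rightarrow> 'k) \<Rightarrow> ('i \<Rightarrow> 'g extended) \<Rightarrow> 'k poly fract \<Rightarrow> int" where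
  "degdom j u s \<delta> \<phi> = weighted_sum \<phi> (limit_critical_points j u s \<delta> \<phi>)"

end

(*
  A critical point alpha that is not a pseudo-limit satisfies u(alpha - s_nu) = const < delta_nu
  eventually, and a pseudo-limit satisfies u(alpha - s_nu) = delta_nu eventually. Factoring phi
  over the algebraic closure gives the value formula with a constant in the value group of u; the
  constant lies in the value group of v because v(c) = delta_nu for some c in K.

  For the independence of u, let v(c) = delta_nu with nu large. The roots alpha of f that are
  pseudo-limits are those with u(alpha - s_nu) >= u(c), and their number is the largest index at
  which the coefficients of f(s_nu + c X) attain their minimal value. This only involves v, so the
  conjugacy of the extensions of v is not needed.
*)

theory Submission
  imports Defs
begin

section \<open>Valuations\<close>

context
  fixes v :: "'a::field \<Rightarrow> 'g::linordered_ab_group_add extended"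
  assumes v: "valuation v"
begin

lemma valuation_mult: "v (x * y) = v x + v y"
  and valuation_add: "min (v x) (v y) \<le> v (x + y)"
  and valuation_eq_Pinf_iff: "v x = Pinf \<longleftrightarrow> x = 0"
  using v by (auto simp: valuation_def)

lemma valuation_eq_Fin_iff: "(\<exists>g. v x = Fin g) \<longleftrightarrow> x \<noteq> 0"
  using v by (cases "v x") (auto simp: valuation_def; metis extended.distinct)+

lemma valuation_finite:
  assumes "x \<noteq> 0"
  obtains g where "v x = Fin g"
  using assms valuation_eq_Fin_iff by blast

lemma valuation_one: "v 1 = Fin 0"
proof -
  obtain g where g: "v 1 = Fin g" using valuation_finite[of 1] by auto
  then show ?thesis using valuation_mult[of 1 1] by simp
qed

lemma valuation_minus: "v (- x) = v x"
proof -
  obtain g where g: "v (- 1) = Fin g" using valuation_finite[of "- 1"] by auto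
  \<comment> \<open>Multiplicativity gives \<open>g + g = 0\<close>, and an ordered abelian group
    has no 2-torsion.\<close>
  then have "g = 0" using valuation_mult[of "- 1" "- 1"] by (simp add: valuation_one)
  then show ?thesis using valuation_mult[of "- 1" x] g by (cases "v x") auto
qed

lemma valuation_diff_commute: "v (x - y) = v (y - x)"
  using valuation_minus[of "x - y"] by simp

lemma valuation_add_eq_left:
  assumes "v x < v y"
  shows "v (x + y) = v x"
proof (rule antisym)
  show "v x \<le> v (x + y)" using valuation_add[of x y] assms by (simp add: min_def split: if_splits)
  have "min (v (x + y)) (v y) \<le> v x"
    using valuation_add[of "x + y" "- y"] valuation_minus[of y] by simp
  then show "v (x + y) \<le> v x" using assms by (auto simp: min_def split: if_splits)
qed

lemma valuation_add_eq_right: "v y < v x \<Longrightarrow> v (x + y) = v y"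
  using valuation_add_eq_left[of y x] by (simp add: add.commute)

lemma valuation_diff_eq:
  assumes "v (x - y) < v (y - z)"
  shows "v (x - z) = v (x - y)"
  using valuation_add_eq_left[OF assms] by simp

lemma valuation_divide:
  assumes "v x = Fin a" "v y = Fin b"
  shows "v (x / y) = Fin (a - b)"
proof -
  have "y \<noteq> 0" using assms(2) valuation_eq_Fin_iff by blast
  then have "v x = v (x / y) + v y" using valuation_mult[of "x / y" y] by simp
  then show ?thesis using assms by (cases "v (x / y)") (auto simp: algebra_simps)
qed

text \<open>The multiple of \<open>a\<close> is kept as an iterated sum to match the sums in
  \<open>int_multiple\<close>.\<close>

lemma valuation_power:
  assumes "v x = Fin a"
  shows "v (x ^ n) = Fin (\<Sum>i<n. a)"
  using assms by (induction n) (simp_all add: valuation_one valuation_mult add.commute)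

end

text \<open>The smaller sum cancels against part of the larger one. With \<open>m\<close> zeros and
  \<open>n\<close> poles this is the value of \<open>c ^ m / c ^ n\<close> when \<open>c\<close> has
  value \<open>Fin g\<close>.\<close>

lemma int_multiple_diff:
  fixes g :: "'g::ab_group_add"
  shows "int_multiple (int m - int n) g = (\<Sum>i<m. g) - (\<Sum>i<n. g)"
proof -
  have add: "(\<Sum>i<k + l. g) = (\<Sum>i<k. g) + (\<Sum>i<l. g)" for k l :: nat
    by (induction l) (simp_all add: add.assoc)
  show ?thesis
  proof (cases "n \<le> m")
    case True
    then obtain k where k: "m = n + k" using le_iff_add by blast
    then show ?thesis by (simp add: int_multiple_def add)
  next
    case False
    then obtain k where k: "n = m + k" using le_iff_add[of m n] by auto
    then show ?thesis by (simp add: int_multiple_def add)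
  qed
qed

section \<open>Dominant indices\<close>

text \<open>The reduction of a polynomial of Gauss value zero has the dominant index as its degree.\<close>

definition dominant_index ::
  "('a::field \<Rightarrow> 'g::linordered_ab_group_add extended) \<Rightarrow> 'a poly \<Rightarrow> nat \<Rightarrow> bool" where
  "dominant_index v f m \<longleftrightarrow>
     (\<forall>i. v (coeff f m) \<le> v (coeff f i)) \<and> (\<forall>i>m. v (coeff f m) < v (coeff f i))"

lemma dominant_index_unique:
  assumes "dominant_index v f m" "dominant_index v f n"
  shows "m = n"
  using assms unfolding dominant_index_def by (metis not_less linorder_neqE_nat)

text \<open>Strictness survives because both lower bounds are finite; \<open>x\<close> and
  \<open>y\<close> may be \<open>Pinf\<close>, the value of a zero coefficient.\<close>

lemma extended_add_less:
  fixes a b :: "'g::linordered_ab_group_add"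
  assumes "Fin a < x" "Fin b \<le> y"
  shows "Fin (a + b) < x + y"
  using assms by (cases x; cases y) (auto simp: add_less_le_mono)

text \<open>This is the Gauss lemma for a linear factor: after scaling, \<open>a + c X\<close>
  reduces to degree 1 if \<open>v c <= v a\<close> and to a nonzero constant otherwise, and degrees
  of reductions add. The proof compares coefficients directly and forms no residue field.\<close>

lemma dominant_index_pCons_mult:
  fixes v :: "'a::field \<Rightarrow> 'g::linordered_ab_group_add extended"
  assumes v: "valuation v" and f: "dominant_index v f m" and "c \<noteq> 0"
  shows "dominant_index v ([:a, c:] * f) (if v c \<le> v a then Suc m else m)"
proof -
  note add = valuation_add[OF v] and mult = valuation_mult[OF v]
  \<comment> \<open>If coefficient \<open>m\<close> had value \<open>Pinf\<close>, coefficient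
    \<open>m + 1\<close> could not have a strictly larger one.\<close>
  have "v (coeff f m) \<noteq> Pinf" "v (coeff f m) \<noteq> Minf"
    using f v unfolding dominant_index_def valuation_def by (metis lessI less_extended_simps(4))+
  then obtain k where k: "v (coeff f m) = Fin k" by (cases "v (coeff f m)") auto
  obtain d where d: "v c = Fin d" using valuation_finite[OF v] \<open>c \<noteq> 0\<close> by blast
  have le: "Fin k \<le> v (coeff f i)" and less: "i > m \<Longrightarrow> Fin k < v (coeff f i)" for i
    using f k unfolding dominant_index_def by metis+
  have coeff: "coeff ([:a, c:] * f) i = a * coeff f i + (case i of 0 \<Rightarrow> 0 | Suc l \<Rightarrow> c * coeff f l)" for i
    by (simp add: coeff_pCons split: nat.split)
  have zero: "v 0 = Pinf" using valuation_eq_Pinf_iff[OF v] by simp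
  have ge: "x \<le> v (p + q)" if "x \<le> v p" "x \<le> v q" for p q x
    using order_trans[OF _ add] that by simp
  have gt: "x < v (p + q)" if "x < v p" "x < v q" for p q x
    using less_le_trans[OF _ add] that by simp
  show ?thesis
  proof (cases "v c \<le> v a")
    case True
    have a: "Fin d \<le> v a" using True d by simp
    \<comment> \<open>The summand \<open>c * coeff f m\<close> alone attains the minimum: the other
      one contains a coefficient past the dominant index.\<close>
    have top: "v (coeff ([:a, c:] * f) (Suc m)) = Fin (d + k)"
      using extended_add_less[OF less[of "Suc m"] a] d k
        valuation_add_eq_right[OF v, of "c * coeff f m" "a * coeff f (Suc m)"]
      by (simp add: coeff mult add.commute)
    have "Fin (d + k) \<le> v (coeff ([:a, c:] * f) i)" for i
      using add_mono[OF a le] add_mono[OF _ le, of "Fin d" "v c"]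
      by (auto simp: coeff mult zero d add.commute simp del: mult_pCons_left split: nat.split intro!: ge)
    moreover have "Fin (d + k) < v (coeff ([:a, c:] * f) i)" if "i > Suc m" for i
      using extended_add_less[OF less a, of i] extended_add_less[OF less, of "i - 1" d "v c"] that
      by (auto simp: coeff mult zero d add.commute simp del: mult_pCons_left split: nat.split intro!: gt)
    ultimately show ?thesis using True top unfolding dominant_index_def by simp
  next
    case False
    then obtain e where e: "v a = Fin e"
      using d v unfolding valuation_def by (cases "v a") auto
    have c: "Fin e < v c" using False e by simp
    \<comment> \<open>The summand with \<open>c\<close> has strictly larger value. It is absent for
      \<open>m = 0\<close>, where \<open>m - 1\<close> truncates, hence the split on
      \<open>m\<close>.\<close>
    have top: "v (coeff ([:a, c:] * f) m) = Fin (e + k)"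
      using extended_add_less[OF c le] e k
        valuation_add_eq_left[OF v, of "a * coeff f m" "c * coeff f (m - 1)"]
      by (cases m) (simp_all add: coeff mult del: mult_pCons_left)
    have "Fin (e + k) \<le> v (coeff ([:a, c:] * f) i)" for i
      using add_mono[OF _ le, of "Fin e" "v a"] less_imp_le[OF extended_add_less[OF c le]]
      by (auto simp: coeff mult zero e add.commute simp del: mult_pCons_left split: nat.split intro!: ge)
    moreover have "Fin (e + k) < v (coeff ([:a, c:] * f) i)" if "i > m" for i
      using extended_add_less[OF less, of i e "v a"] extended_add_less[OF c le] that
      by (auto simp: coeff mult zero e add.commute simp del: mult_pCons_left split: nat.split intro!: gt)
    ultimately show ?thesis using False top unfolding dominant_index_def by simp
  qed
qed

section \<open>Products of linear factors and counting roots in a ball\<close>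

abbreviation linear_factors :: "'a::field multiset \<Rightarrow> 'a poly" where
  "linear_factors M \<equiv> \<Prod>\<alpha>\<in>#M. [:- \<alpha>, 1:]"

lemma linear_factors_neq_0: "linear_factors M \<noteq> 0"
  by (auto simp: prod_mset_zero_iff)

lemma linear_factors_partition:
  "linear_factors M = linear_factors {#\<alpha> \<in># M. P \<alpha>#} * linear_factors {#\<alpha> \<in># M. \<not> P \<alpha>#}"
  by (induction M) (simp_all del: mult_pCons_left mult_pCons_right add: mult_ac)

text \<open>Algebraic closedness yields a factorization with some multiset \<open>A\<close>; taking
  \<open>proots\<close> on both sides identifies \<open>A\<close>.\<close>

lemma poly_eq_linear_factors:
  fixes p :: "'a::alg_closed_field poly"
  assumes "p \<noteq> 0"
  shows "p = smult (lead_coeff p) (linear_factors (proots p))"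
proof -
  obtain A where A: "p = smult (lead_coeff p) (linear_factors A)"
    using alg_closed_imp_factorization[OF assms] by blast
  have "proots p = proots (linear_factors A)"
    by (subst A) (use assms in simp)
  also have "\<dots> = A"
  proof (induction A)
    case (add x A)
    then show ?case
      using proots_mult[of "[:- x, 1:]" "linear_factors A"] linear_factors_neq_0[of A]
      by (simp del: mult_pCons_left)
  qed simp
  finally show ?thesis using A by simp
qed

text \<open>The substitution turns \<open>X - \<alpha>\<close> into
  \<open>(a - \<alpha>) + c X\<close>, which raises the dominant index by one exactly when
  \<open>\<alpha>\<close> lies in the closed ball around \<open>a\<close> with radius given by
  \<open>v c\<close>.\<close>

lemma dominant_index_pcompose_linear_factors:
  assumes v: "valuation v" and "c \<noteq> 0" "l \<noteq> 0"
  shows "dominant_index v (smult l (linear_factors M) \<circ>\<^sub>p [:a, c:])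
           (size {#\<alpha> \<in># M. v c \<le> v (\<alpha> - a)#})"
proof (induction M)
  case empty
  obtain g where "v l = Fin g" using valuation_finite[OF v] assms(3) by blast
  then show ?case using valuation_eq_Pinf_iff[OF v, of 0]
    by (auto simp: dominant_index_def coeff_pCons pcompose_smult pcompose_1 split: nat.split)
next
  case (add \<alpha> M)
  have "[:- \<alpha>, 1:] \<circ>\<^sub>p [:a, c:] = [:a - \<alpha>, c:]" by (simp add: pcompose_pCons)
  then have "smult l (linear_factors (add_mset \<alpha> M)) \<circ>\<^sub>p [:a, c:] =
      [:a - \<alpha>, c:] * (smult l (linear_factors M) \<circ>\<^sub>p [:a, c:])"
    by (simp add: pcompose_mult pcompose_smult del: mult_pCons_left)
  then show ?case
    using dominant_index_pCons_mult[OF v add.IH \<open>c \<noteq> 0\<close>, of "a - \<alpha>"]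
    by (simp add: valuation_diff_commute[OF v, of a \<alpha>] if_distrib)
qed

section \<open>Polynomials over the algebraic closure\<close>

lemma map_poly_to_ac_add: "map_poly to_ac (p + q) = map_poly to_ac p + map_poly to_ac q"
  by (rule poly_eqI) (simp add: coeff_map_poly)

lemma map_poly_to_ac_mult: "map_poly to_ac (p * q) = map_poly to_ac p * map_poly to_ac q"
  by (rule poly_eqI) (simp add: coeff_map_poly coeff_mult to_ac_sum)

lemma map_poly_to_ac_pcompose:
  "map_poly to_ac (p \<circ>\<^sub>p q) = map_poly to_ac p \<circ>\<^sub>p map_poly to_ac q"
  by (induction p)
    (simp_all add: pcompose_pCons map_poly_pCons map_poly_to_ac_add map_poly_to_ac_mult)

lemma poly_map_poly_to_ac: "poly (map_poly to_ac p) (to_ac x) = to_ac (poly p x)"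
  by (induction p) (simp_all add: map_poly_pCons)

lemma map_poly_to_ac_eq_0_iff: "map_poly to_ac p = 0 \<longleftrightarrow> p = 0"
  by (simp add: poly_eq_iff coeff_map_poly)

section \<open>Lowest terms over \<open>K\<close> and over its algebraic closure\<close>

lemma rat_quot_neq_0:
  assumes "\<phi> \<noteq> 0"
  shows "fst (rat_quot \<phi>) \<noteq> 0" "snd (rat_quot \<phi>) \<noteq> 0"
proof -
  show "snd (rat_quot \<phi>) \<noteq> 0" by (rule rat_quot)
  then have "Fract 0 (snd (rat_quot \<phi>)) = 0" by (simp add: Zero_fract_def eq_fract)
  then show "fst (rat_quot \<phi>) \<noteq> 0" using rat_quot(3)[of \<phi>] assms by metis
qed

lemma rat_to_ac_neq_0: "\<phi> \<noteq> 0 \<Longrightarrow> rat_to_ac \<phi> \<noteq> 0"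
  using rat_quot_neq_0[of \<phi>]
  by (simp add: rat_to_ac_def Zero_fract_def eq_fract map_poly_to_ac_eq_0_iff)

text \<open>Lowest terms are chosen separately over the two fields, so the two representatives are
  related by cross multiplication only.\<close>

lemma rat_quot_rat_to_ac:
  "fst (rat_quot (rat_to_ac \<phi>)) * map_poly to_ac (snd (rat_quot \<phi>)) =
   map_poly to_ac (fst (rat_quot \<phi>)) * snd (rat_quot (rat_to_ac \<phi>))"
  using rat_quot(1)[of \<phi>] rat_quot(1,3)[of "rat_to_ac \<phi>"]
  by (simp add: rat_to_ac_def[of \<phi>] eq_fract map_poly_to_ac_eq_0_iff)

text \<open>If the denominator over \<open>K\<close> vanished at \<open>x\<close>, the cross
  relation would make the numerator vanish there too, against coprimality.\<close>

lemma to_ac_rat_eval: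
  fixes \<phi> :: "'k::field poly fract"
  assumes "poly (snd (rat_quot (rat_to_ac \<phi>))) (to_ac x) \<noteq> 0"
  shows "to_ac (rat_eval \<phi> x) = rat_eval (rat_to_ac \<phi>) (to_ac x)"
proof -
  let ?p = "fst (rat_quot \<phi>)" and ?q = "snd (rat_quot \<phi>)"
  have "poly ?q x \<noteq> 0"
  proof
    assume q: "poly ?q x = 0"
    have "poly (fst (rat_quot (rat_to_ac \<phi>)) * map_poly to_ac ?q) (to_ac x) =
        poly (map_poly to_ac ?p * snd (rat_quot (rat_to_ac \<phi>))) (to_ac x)"
      by (simp only: rat_quot_rat_to_ac)
    then have "poly ?p x = 0" using q assms by (simp add: poly_map_poly_to_ac)
    with q have "[:- x, 1:] dvd ?p" "[:- x, 1:] dvd ?q" by (simp_all add: poly_eq_0_iff_dvd)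
    then have "is_unit [:- x, 1:]" using rat_quot(2) coprime_common_divisor by blast
    then show False by (simp add: is_unit_iff_degree)
  qed
  then show ?thesis
    using rat_eval_Fract[of "map_poly to_ac ?q" "to_ac x" "map_poly to_ac ?p"]
    by (simp add: rat_to_ac_def rat_eval_def[of \<phi>] poly_map_poly_to_ac)
qed

text \<open>A common root would be a non-unit common divisor of coprime polynomials. This forces
  \<open>crit_sign\<close> to be -1 at every pole.\<close>

lemma zeros_poles_disjoint:
  fixes \<phi> :: "'k::field poly fract"
  assumes "\<phi> \<noteq> 0" "\<alpha> \<in># rat_poles (rat_to_ac \<phi>)"
  shows "\<alpha> \<notin># rat_zeros (rat_to_ac \<phi>)"
proof
  let ?a = "fst (rat_quot (rat_to_ac \<phi>))" and ?b = "snd (rat_quot (rat_to_ac \<phi>))"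
  assume "\<alpha> \<in># rat_zeros (rat_to_ac \<phi>)"
  then have "[:- \<alpha>, 1:] dvd ?a" "[:- \<alpha>, 1:] dvd ?b"
    using assms rat_quot_neq_0[OF rat_to_ac_neq_0[OF assms(1)]]
    by (simp_all add: rat_zeros_def rat_poles_def poly_eq_0_iff_dvd)
  then have "is_unit [:- \<alpha>, 1:]" using rat_quot(2) coprime_common_divisor by blast
  then show False by (simp add: is_unit_iff_degree)
qed

section \<open>Pseudo-limits\<close>

text \<open>A single extension is fixed; the comparison of \<open>u\<close> with \<open>u'\<close>
  uses two instances of this locale sharing \<open>v\<close>, \<open>s\<close> and
  \<open>\<delta>\<close>.\<close>

locale pseudo_monotone_extension =
  fixes v :: "'k::field \<Rightarrow> 'g::linordered_ab_group_add extended"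
    and s :: "'i::{wellorder, no_top} \<Rightarrow> 'k"
    and \<delta> :: "'i \<Rightarrow> 'g extended"
    and j :: "'g \<Rightarrow> 'h::linordered_ab_group_add"
    and u :: "'k alg_closure \<Rightarrow> 'h extended"
  assumes v: "valuation v" and monotone: "pseudo_monotone v s" and gauge: "is_gauge v s \<delta>"
    and extends: "extends_valuation j v u"
begin

lemma u: "valuation u"
  and u_to_ac: "u (to_ac x) = map_extended j (v x)"
  and j_mono: "strict_mono_on (value_group v) j"
  using extends by (auto simp: extends_valuation_def)

text \<open>Monotonicity of \<open>j\<close> is known on the value group only, so the comparison is
  stated for values attained by \<open>v\<close>.\<close>

lemma map_extended_j_le: "map_extended j (v x) \<le> map_extended j (v y) \<longleftrightarrow> v x \<le> v y"
proof -
  have "v x \<noteq> Minf" "v y \<noteq> Minf" using v by (auto simp: valuation_def)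
  then consider "v x = Pinf" | "v y = Pinf" | a b where "v x = Fin a" "v y = Fin b"
    by (cases "v x"; cases "v y") auto
  then show ?thesis
  proof cases
    case (3 a b)
    then have "a \<in> value_group v" "b \<in> value_group v" by (auto simp: value_group_def)
    then show ?thesis using 3 strict_mono_on_less_eq[OF j_mono] by simp
  qed (cases "v y"; cases "v x"; simp)+
qed

lemma map_extended_j_less: "map_extended j (v x) < map_extended j (v y) \<longleftrightarrow> v x < v y"
  by (simp add: map_extended_j_le flip: not_le)

lemma map_extended_j_eq: "map_extended j (v x) = map_extended j (v y) \<longleftrightarrow> v x = v y"
  by (simp add: order_eq_iff map_extended_j_le)

lemma u_diff_to_ac: "u (to_ac x - to_ac y) = map_extended j (v (x - y))"
  by (simp flip: to_ac_diff add: u_to_ac)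

text \<open>Dominance only compares values of coefficients, and \<open>j\<close> preserves and
  reflects their order. This brings root counts made with \<open>u\<close> down to
  \<open>v\<close>.\<close>

lemma dominant_index_map_poly:
  "dominant_index u (map_poly to_ac f) m \<longleftrightarrow> dominant_index v f m"
  by (simp add: dominant_index_def coeff_map_poly u_to_ac map_extended_j_less map_extended_j_le)

abbreviation "plim \<equiv> pseudo_limit j u s \<delta>"

lemma lim_iff: "plim \<alpha> \<longleftrightarrow> (\<forall>\<^sub>F \<nu> in at_top. u (\<alpha> - to_ac (s \<nu>)) = map_extended j (\<delta> \<nu>))"
  by (simp add: pseudo_limit_def eventually_at_top_linorder)

text \<open>The witness is a difference of two terms of the sequence, nonzero by strict monotonicity
  or injectivity. In the pseudo-divergent case the first two indices may fail, hence the eventual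
  form.\<close>

lemma gauge_attained: "\<forall>\<^sub>F \<nu> in at_top. \<exists>c. c \<noteq> 0 \<and> v c = \<delta> \<nu>"
  using monotone unfolding pseudo_monotone_def
proof (elim disjE)
  assume pc: "pseudo_convergent v s"
  have "\<exists>c. c \<noteq> 0 \<and> v c = \<delta> \<nu>" for \<nu>
  proof -
    obtain \<rho> \<sigma> where *: "\<nu> < \<rho>" "\<rho> < \<sigma>" using gt_ex by metis
    then have "v (s \<rho> - s \<nu>) < v (s \<sigma> - s \<rho>)" using pc unfolding pseudo_convergent_def by blast
    then have "s \<rho> - s \<nu> \<noteq> 0" using valuation_eq_Pinf_iff[OF v, of "s \<rho> - s \<nu>"] by fastforce
    then show ?thesis using gauge pc *(1) unfolding is_gauge_def by metis
  qed
  then show ?thesis by simp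
next
  assume pd: "pseudo_divergent v s"
  \<comment> \<open>Having \<open>\<rho>\<close> below \<open>\<nu>0\<close> makes every later
    difference from \<open>s \<nu>0\<close> strictly smaller in value than
    \<open>s \<nu>0 - s \<rho>\<close>, hence finite.\<close>
  obtain \<rho> \<nu>0 :: 'i where *: "\<rho> < \<nu>0" using gt_ex by metis
  have "\<exists>c. c \<noteq> 0 \<and> v c = \<delta> \<nu>" if \<nu>: "\<nu>0 < \<nu>" for \<nu>
  proof -
    have "v (s \<nu> - s \<nu>0) < v (s \<nu>0 - s \<rho>)" using pd that * unfolding pseudo_divergent_def by blast
    then have "s \<nu>0 - s \<nu> \<noteq> 0"
      using valuation_eq_Pinf_iff[OF v, of "s \<nu> - s \<nu>0"] by fastforce
    moreover have "\<delta> \<nu> = v (s \<nu>0 - s \<nu>)" using gauge pd \<nu> unfolding is_gauge_def by blast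
    ultimately show ?thesis by metis
  qed
  then show ?thesis by (rule eventually_mono[OF eventually_gt_at_top])
next
  assume ps: "pseudo_stationary v s"
  obtain \<rho> \<mu> :: 'i where *: "\<rho> < \<mu>" using gt_ex by metis
  then have "s \<rho> - s \<mu> \<noteq> 0" using ps by (auto simp: pseudo_stationary_def inj_def)
  moreover have "v (s \<rho> - s \<mu>) = \<delta> \<nu>" for \<nu>
    using gauge ps * unfolding is_gauge_def by (metis less_irrefl)
  ultimately show ?thesis by (intro always_eventually) metis
qed

text \<open>The bound by the gauge gives \<open>u (\<beta> - \<alpha>) = g\<close> for every pseudo-limit \<open>\<beta>\<close>.\<close>

lemma not_lim:
  assumes "\<not> plim \<alpha>"
  shows "\<exists>g. \<forall>\<^sub>F \<nu> in at_top. u (\<alpha> - to_ac (s \<nu>)) = Fin g \<and> Fin g < map_extended j (\<delta> \<nu>)"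
proof -
  let ?w = "\<lambda>\<nu>. u (\<alpha> - to_ac (s \<nu>))"
  let ?d = "\<lambda>\<nu>. map_extended j (\<delta> \<nu>)"
  let ?uu = "\<lambda>\<nu> \<rho>. u (to_ac (s \<nu>) - to_ac (s \<rho>))"
  have Fin: "\<exists>g. ?w \<nu> = Fin g" if "?w \<nu> < ?d \<nu>" for \<nu>
    using that u by (cases "?w \<nu>") (auto simp: valuation_def)
  have eq_left: "?w \<rho> = ?w \<nu>" if "?w \<nu> < ?uu \<nu> \<rho>" for \<nu> \<rho>
    using valuation_diff_eq[OF u that] .
  have eq_right: "?w \<rho> = ?uu \<nu> \<rho>" if "?uu \<nu> \<rho> < ?w \<nu>" for \<nu> \<rho>
    using valuation_add_eq_right[OF u, of "to_ac (s \<nu>) - to_ac (s \<rho>)" "\<alpha> - to_ac (s \<nu>)"] that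
    by simp
  \<comment> \<open>Each case below contradicts this by propagating equality with the gauge to all
    large indices.\<close>
  have not_lim: "\<not> (\<forall>\<rho>>\<nu>. ?w \<rho> = ?d \<rho>)" for \<nu>
  proof
    assume *: "\<forall>\<rho>>\<nu>. ?w \<rho> = ?d \<rho>"
    have "\<forall>\<^sub>F \<rho> in at_top. ?w \<rho> = ?d \<rho>"
      using eventually_gt_at_top[of \<nu>] by eventually_elim (use * in blast)
    then show False using assms lim_iff by blast
  qed
  show ?thesis
    using monotone unfolding pseudo_monotone_def
  proof (elim disjE)
    assume pc: "pseudo_convergent v s"
    have uu: "?uu \<nu> \<rho> = ?d \<nu>" if "\<nu> < \<rho>" for \<nu> \<rho>
      using gauge pc that valuation_diff_commute[OF v, of "s \<nu>" "s \<rho>"]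
      unfolding is_gauge_def u_diff_to_ac by metis
    have mono: "?d \<nu> < ?d \<rho>" if "\<nu> < \<rho>" for \<nu> \<rho>
    proof -
      obtain \<sigma> where \<sigma>: "\<rho> < \<sigma>" using gt_ex by blast
      have "v (s \<rho> - s \<nu>) < v (s \<sigma> - s \<rho>)" using pc that \<sigma> unfolding pseudo_convergent_def by blast
      moreover have "\<delta> \<nu> = v (s \<rho> - s \<nu>)" "\<delta> \<rho> = v (s \<sigma> - s \<rho>)"
        using gauge pc that \<sigma> unfolding is_gauge_def by blast+
      ultimately show ?thesis by (simp add: map_extended_j_less)
    qed
    \<comment> \<open>If \<open>?w\<close> never fell below the gauge, a strict excess at
      \<open>\<nu>\<close> would give \<open>?w \<rho> = ?d \<nu> < ?d \<rho>\<close> at a later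
      \<open>\<rho>\<close>. So equality would hold everywhere.\<close>
    have "\<exists>\<nu>. ?w \<nu> < ?d \<nu>"
    proof (rule ccontr)
      assume "\<nexists>\<nu>. ?w \<nu> < ?d \<nu>"
      then have ge: "?d \<nu> \<le> ?w \<nu>" for \<nu> using not_less by blast
      have "?w \<nu> = ?d \<nu>" for \<nu>
      proof (rule ccontr)
        obtain \<rho> where \<rho>: "\<nu> < \<rho>" using gt_ex by blast
        assume "?w \<nu> \<noteq> ?d \<nu>"
        then have "?uu \<nu> \<rho> < ?w \<nu>" using ge[of \<nu>] uu[OF \<rho>] by simp
        then have "?w \<rho> < ?d \<rho>" using eq_right[of \<nu> \<rho>] uu[OF \<rho>] mono[OF \<rho>] by simp
        then show False using ge[of \<rho>] by simp
      qed
      then show False using not_lim by blast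
    qed
    then obtain \<nu> g where \<nu>: "?w \<nu> < ?d \<nu>" and g: "?w \<nu> = Fin g" using Fin by blast
    have "\<forall>\<^sub>F \<rho> in at_top. ?w \<rho> = Fin g \<and> Fin g < ?d \<rho>"
      using eventually_gt_at_top[of \<nu>]
    proof eventually_elim
      case (elim \<rho>)
      then show ?case using eq_left[of \<nu> \<rho>] \<nu> g uu[OF elim] mono[OF elim] by simp
    qed
    then show ?thesis by blast
  next
    assume pd: "pseudo_divergent v s"
    have uu: "?uu \<nu> \<rho> = ?d \<rho>" if "\<nu> < \<rho>" for \<nu> \<rho>
      using gauge pd that unfolding is_gauge_def u_diff_to_ac by metis
    \<comment> \<open>The extra index \<open>\<mu>\<close> keeps \<open>\<nu>\<close> off the
      minimum, where the gauge is arbitrary.\<close>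
    have mono: "?d \<rho> < ?d \<nu>" if "\<mu> < \<nu>" "\<nu> < \<rho>" for \<mu> \<nu> \<rho>
    proof -
      have "v (s \<rho> - s \<nu>) < v (s \<nu> - s \<mu>)" using pd that unfolding pseudo_divergent_def by blast
      moreover have "\<delta> \<nu> = v (s \<mu> - s \<nu>)" "\<delta> \<rho> = v (s \<nu> - s \<rho>)"
        using gauge pd that unfolding is_gauge_def by blast+
      ultimately show ?thesis
        by (simp add: map_extended_j_less valuation_diff_commute[OF v, of "s \<mu>"]
          valuation_diff_commute[OF v, of "s \<nu>" "s \<rho>"])
    qed
    obtain \<mu> \<nu> :: 'i where \<mu>: "\<mu> < \<nu>" using gt_ex by metis
    \<comment> \<open>Otherwise \<open>?w \<nu>\<close> exceeds \<open>?d \<rho>\<close> for every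
      later \<open>\<rho>\<close>, because the gauge decreases, and then
      \<open>?w \<rho> = ?d \<rho>\<close> for all of them.\<close>
    have less: "?w \<nu> < ?d \<nu>" if \<nu>: "\<mu> < \<nu>" for \<nu>
    proof (rule ccontr)
      assume *: "\<not> ?w \<nu> < ?d \<nu>"
      have "?w \<rho> = ?d \<rho>" if \<rho>: "\<nu> < \<rho>" for \<rho>
        using eq_right[of \<nu> \<rho>] uu[OF \<rho>] mono[OF \<nu> \<rho>] * by simp
      then show False using not_lim by blast
    qed
    \<comment> \<open>The constant is read off at the fixed \<open>\<nu>\<close>: for later
      \<open>\<rho>\<close> the difference of the two terms has value \<open>?d \<rho>\<close>,
      above \<open>?w \<rho>\<close>, so both distances from \<open>\<alpha>\<close> agree.\<close>
    obtain g where g: "?w \<nu> = Fin g" using Fin[OF less[OF \<mu>]] by blast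
    have "\<forall>\<^sub>F \<rho> in at_top. ?w \<rho> = Fin g \<and> Fin g < ?d \<rho>"
      using eventually_gt_at_top[of \<nu>]
    proof eventually_elim
      case (elim \<rho>)
      have "?w \<rho> < ?d \<rho>" using less less_trans[OF \<mu> elim] .
      moreover have "?uu \<rho> \<nu> = ?d \<rho>"
        using uu[OF elim] valuation_diff_commute[OF u, of "to_ac (s \<rho>)"] by simp
      ultimately show ?case using eq_left[of \<rho> \<nu>] g by simp
    qed
    then show ?thesis by blast
  next
    assume ps: "pseudo_stationary v s"
    have uu: "?uu \<nu> \<rho> = ?d \<sigma>" if "\<nu> \<noteq> \<rho>" for \<nu> \<rho> \<sigma>
      using gauge ps that unfolding is_gauge_def u_diff_to_ac by metis
    have const: "?d \<nu> = ?d \<rho>" for \<nu> \<rho>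
    proof -
      obtain \<sigma> where "\<rho> < \<sigma>" using gt_ex by blast
      then show ?thesis using uu[of \<rho> \<sigma> \<nu>] uu[of \<rho> \<sigma> \<rho>] by simp
    qed
    have "\<exists>\<nu>. ?w \<nu> < ?d \<nu>"
    proof (rule ccontr)
      assume "\<nexists>\<nu>. ?w \<nu> < ?d \<nu>"
      then have ge: "?d \<nu> \<le> ?w \<nu>" for \<nu> using not_less by blast
      \<comment> \<open>Strict excess at a single index forces the constant gauge value at all later
        ones.\<close>
      obtain \<nu> where "?w \<nu> \<noteq> ?d \<nu>" using not_lim by blast
      then have "?d \<nu> < ?w \<nu>" using ge[of \<nu>] by simp
      then have "?w \<rho> = ?d \<rho>" if \<rho>: "\<nu> < \<rho>" for \<rho>
        using eq_right[of \<nu> \<rho>] uu[of \<nu> \<rho> \<rho>] const[of \<nu> \<rho>] \<rho> by simp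
      then show False using not_lim by blast
    qed
    then obtain \<nu> g where \<nu>: "?w \<nu> < ?d \<nu>" and g: "?w \<nu> = Fin g" using Fin by blast
    have "\<forall>\<^sub>F \<rho> in at_top. ?w \<rho> = Fin g \<and> Fin g < ?d \<rho>"
      using eventually_gt_at_top[of \<nu>]
    proof eventually_elim
      case (elim \<rho>)
      then show ?case using eq_left[of \<nu> \<rho>] \<nu> g uu[of \<nu> \<rho> \<rho>] const[of \<nu> \<rho>] by auto
    qed
    then show ?thesis by blast
  qed
qed

text \<open>Pseudo-limits meet the gauge and other elements fall strictly below it, so being a
  pseudo-limit becomes membership in a closed ball around \<open>s \<nu>\<close>.\<close>

lemma eventually_lim_iff:
  "\<forall>\<^sub>F \<nu> in at_top. plim \<alpha> \<longleftrightarrow> map_extended j (\<delta> \<nu>) \<le> u (\<alpha> - to_ac (s \<nu>))"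
proof (cases "plim \<alpha>")
  case True
  then show ?thesis unfolding lim_iff by (rule eventually_mono) (use True lim_iff in auto)
next
  case False
  then obtain g where "\<forall>\<^sub>F \<nu> in at_top. u (\<alpha> - to_ac (s \<nu>)) = Fin g \<and> Fin g < map_extended j (\<delta> \<nu>)"
    using not_lim by blast
  then show ?thesis by (rule eventually_mono) (use False in auto)
qed

text \<open>For \<open>c\<close> of value \<open>\<delta> \<nu>\<close> the root count in the ball
  is the count of pseudo-limits. Allowing every such \<open>c\<close> lets two extensions be
  compared at the same polynomial.\<close>

lemma eventually_dominant_index:
  assumes "f \<noteq> 0"
  shows "\<forall>\<^sub>F \<nu> in at_top. \<forall>c. c \<noteq> 0 \<longrightarrow> v c = \<delta> \<nu> \<longrightarrow>
    dominant_index v (f \<circ>\<^sub>p [:s \<nu>, c:]) (size {#\<alpha> \<in># proots (map_poly to_ac f). plim \<alpha>#})"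
proof -
  let ?F = "map_poly to_ac f" and ?M = "proots (map_poly to_ac f)"
  have F: "?F \<noteq> 0" using assms map_poly_to_ac_eq_0_iff by blast
  \<comment> \<open>There are finitely many roots, so one bound on \<open>\<nu>\<close> serves all
    of them.\<close>
  have "\<forall>\<^sub>F \<nu> in at_top. \<forall>\<alpha>\<in>set_mset ?M. plim \<alpha> \<longleftrightarrow> map_extended j (\<delta> \<nu>) \<le> u (\<alpha> - to_ac (s \<nu>))"
    by (rule eventually_ball_finite) (use eventually_lim_iff in auto)
  then show ?thesis
  proof (rule eventually_mono, intro allI impI)
    fix \<nu> c
    assume lim: "\<forall>\<alpha>\<in>set_mset ?M. plim \<alpha> \<longleftrightarrow> map_extended j (\<delta> \<nu>) \<le> u (\<alpha> - to_ac (s \<nu>))"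
      and c: "c \<noteq> 0" "v c = \<delta> \<nu>"
    have "{#\<alpha> \<in># ?M. plim \<alpha>#} = {#\<alpha> \<in># ?M. u (to_ac c) \<le> u (\<alpha> - to_ac (s \<nu>))#}"
      using lim c by (intro filter_mset_cong) (auto simp: u_to_ac)
    then have "dominant_index u (?F \<circ>\<^sub>p [:to_ac (s \<nu>), to_ac c:]) (size {#\<alpha> \<in># ?M. plim \<alpha>#})"
      using dominant_index_pcompose_linear_factors[OF u, of "to_ac c" "lead_coeff ?F" ?M "to_ac (s \<nu>)"]
        c F poly_eq_linear_factors[OF F] by simp
    moreover have "?F \<circ>\<^sub>p [:to_ac (s \<nu>), to_ac c:] = map_poly to_ac (f \<circ>\<^sub>p [:s \<nu>, c:])"
      by (simp add: map_poly_to_ac_pcompose map_poly_pCons)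
    ultimately show "dominant_index v (f \<circ>\<^sub>p [:s \<nu>, c:]) (size {#\<alpha> \<in># ?M. plim \<alpha>#})"
      by (simp add: dominant_index_map_poly)
  qed
qed

text \<open>Every factor has the value of \<open>c\<close>. Expressing the result by a power of an
  element of \<open>K\<close> allows dividing it out later without leaving \<open>K\<close>.\<close>

lemma u_linear_factors_lim:
  assumes "\<forall>\<alpha>\<in>#M. plim \<alpha>"
  shows "\<forall>\<^sub>F \<nu> in at_top. \<forall>c. v c = \<delta> \<nu> \<longrightarrow>
    u (poly (linear_factors M) (to_ac (s \<nu>))) = u (to_ac c ^ size M)"
  using assms
proof (induction M)
  case empty
  then show ?case by simp
next
  case (add \<alpha> M)
  have "\<forall>\<^sub>F \<nu> in at_top. u (\<alpha> - to_ac (s \<nu>)) = map_extended j (\<delta> \<nu>)"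
    using add.prems lim_iff by auto
  moreover have "\<forall>\<^sub>F \<nu> in at_top. \<forall>c. v c = \<delta> \<nu> \<longrightarrow>
      u (poly (linear_factors M) (to_ac (s \<nu>))) = u (to_ac c ^ size M)"
    using add by simp
  ultimately show ?case
  proof eventually_elim
    case (elim \<nu>)
    have "poly (linear_factors (add_mset \<alpha> M)) (to_ac (s \<nu>)) =
        (to_ac (s \<nu>) - \<alpha>) * poly (linear_factors M) (to_ac (s \<nu>))"
      by (simp add: algebra_simps)
    then show ?case
      using elim
      by (simp add: valuation_mult[OF u] u_to_ac valuation_diff_commute[OF u, of "to_ac (s \<nu>)"]
          del: to_ac_power)
  qed
qed

text \<open>Each factor eventually has a constant value below the gauge. Since
  \<open>\<beta>\<close> is closer to \<open>s \<nu>\<close> than \<open>\<alpha>\<close> is,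
  \<open>\<beta> - \<alpha>\<close> has this same value, so one constant serves both claims.\<close>

lemma u_linear_factors_not_lim:
  assumes "\<forall>\<alpha>\<in>#M. \<not> plim \<alpha>"
  shows "\<exists>g. (\<forall>\<^sub>F \<nu> in at_top. u (poly (linear_factors M) (to_ac (s \<nu>))) = Fin g) \<and>
    (\<forall>\<beta>. plim \<beta> \<longrightarrow> u (poly (linear_factors M) \<beta>) = Fin g)"
  using assms
proof (induction M)
  case empty
  then show ?case by (auto simp: valuation_one[OF u])
next
  case (add \<alpha> M)
  then obtain g where g: "\<forall>\<^sub>F \<nu> in at_top. u (poly (linear_factors M) (to_ac (s \<nu>))) = Fin g"
    "\<forall>\<beta>. plim \<beta> \<longrightarrow> u (poly (linear_factors M) \<beta>) = Fin g" by auto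
  obtain h where h: "\<forall>\<^sub>F \<nu> in at_top. u (\<alpha> - to_ac (s \<nu>)) = Fin h \<and> Fin h < map_extended j (\<delta> \<nu>)"
    using not_lim add.prems by auto
  have poly: "poly (linear_factors (add_mset \<alpha> M)) x = (x - \<alpha>) * poly (linear_factors M) x" for x
    by (simp add: algebra_simps)
  have "\<forall>\<^sub>F \<nu> in at_top. u (poly (linear_factors (add_mset \<alpha> M)) (to_ac (s \<nu>))) = Fin (h + g)"
    using g(1) h
    by eventually_elim
      (simp only: poly valuation_mult[OF u] valuation_diff_commute[OF u, of "to_ac _" \<alpha>] plus_extended.simps)
  moreover have "u (poly (linear_factors (add_mset \<alpha> M)) \<beta>) = Fin (h + g)" if \<beta>: "plim \<beta>" for \<beta>
  proof -
    obtain \<nu> where "u (\<alpha> - to_ac (s \<nu>)) = Fin h" "Fin h < map_extended j (\<delta> \<nu>)"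
      "u (\<beta> - to_ac (s \<nu>)) = map_extended j (\<delta> \<nu>)"
      using eventually_happens'[OF trivial_limit_at_top_linorder eventually_conj[OF h lim_iff[THEN iffD1, OF \<beta>]]]
      by blast
    then have "u (\<alpha> - \<beta>) = Fin h"
      using valuation_diff_eq[OF u, of \<alpha> "to_ac (s \<nu>)" \<beta>]
        valuation_diff_commute[OF u, of \<beta> "to_ac (s \<nu>)"] by simp
    then show ?thesis
      using g(2) \<beta>
      by (simp only: poly valuation_mult[OF u] valuation_diff_commute[OF u, of \<beta> \<alpha>] plus_extended.simps)
  qed
  ultimately show ?case by blast
qed


section \<open>Dominating degree and S-part in terms of zeros and poles\<close>

lemma limit_critical_points_eq:
  "limit_critical_points j u s \<delta> \<phi> =
     filter_mset plim (rat_zeros (rat_to_ac \<phi>)) + filter_mset plim (rat_poles (rat_to_ac \<phi>))"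
  by (simp add: limit_critical_points_def critical_points_def)

lemma degdom_eq:
  assumes "\<phi> \<noteq> 0"
  shows "degdom j u s \<delta> \<phi> =
    int (size (filter_mset plim (rat_zeros (rat_to_ac \<phi>)))) -
    int (size (filter_mset plim (rat_poles (rat_to_ac \<phi>))))"
proof -
  have "(\<Sum>\<alpha>\<in>#filter_mset plim (rat_poles (rat_to_ac \<phi>)). crit_sign \<phi> \<alpha>) =
      (\<Sum>\<alpha>\<in>#filter_mset plim (rat_poles (rat_to_ac \<phi>)). - 1)"
    using zeros_poles_disjoint[OF assms]
    by (intro arg_cong[where f = sum_mset] image_mset_cong) (auto simp: crit_sign_def)
  moreover have "(\<Sum>\<alpha>\<in>#filter_mset plim (rat_zeros (rat_to_ac \<phi>)). crit_sign \<phi> \<alpha>) =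
      (\<Sum>\<alpha>\<in>#filter_mset plim (rat_zeros (rat_to_ac \<phi>)). 1)"
    by (intro arg_cong[where f = sum_mset] image_mset_cong) (auto simp: crit_sign_def)
  ultimately show ?thesis
    by (simp add: degdom_def weighted_sum_def limit_critical_points_eq)
qed

lemma S_part_limit_critical_points:
  assumes "\<phi> \<noteq> 0"
  shows "S_part \<phi> (limit_critical_points j u s \<delta> \<phi>) =
    Fract (linear_factors (filter_mset plim (rat_zeros (rat_to_ac \<phi>))))
      (linear_factors (filter_mset plim (rat_poles (rat_to_ac \<phi>))))"
proof -
  have Z: "(\<Prod>\<alpha>\<in>#M. Fract [:- \<alpha>, 1:] 1 powi crit_sign \<phi> \<alpha>) = Fract (linear_factors M) 1"
    if "set_mset M \<subseteq> set_mset (rat_zeros (rat_to_ac \<phi>))" for M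
    using that by (induction M) (auto simp: crit_sign_def One_fract_def simp del: mult_pCons_left)
  have P: "(\<Prod>\<alpha>\<in>#M. Fract [:- \<alpha>, 1:] 1 powi crit_sign \<phi> \<alpha>) = Fract 1 (linear_factors M)"
    if "set_mset M \<subseteq> set_mset (rat_poles (rat_to_ac \<phi>))" for M
    using that
  proof (induction M)
    case (add \<alpha> M)
    then have "crit_sign \<phi> \<alpha> = - 1"
      using zeros_poles_disjoint[OF assms] by (auto simp: crit_sign_def)
    then show ?case using add by (simp add: power_int_minus del: mult_pCons_left)
  qed (simp add: One_fract_def)
  show ?thesis
    using Z[of "filter_mset plim (rat_zeros (rat_to_ac \<phi>))"]
      P[of "filter_mset plim (rat_poles (rat_to_ac \<phi>))"]
    by (simp add: S_part_def limit_critical_points_eq)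
qed

text \<open>Critical points come from lowest terms over the closure, whereas the root count concerns
  polynomials over \<open>K\<close>. The cross relation equates \<open>proots ?a + proots ?q\<close>
  with \<open>proots ?p + proots ?b\<close>, so the differences of the counts agree.\<close>

lemma degdom_eq_base:
  assumes "\<phi> \<noteq> 0"
  shows "degdom j u s \<delta> \<phi> =
    int (size {#\<alpha> \<in># proots (map_poly to_ac (fst (rat_quot \<phi>))). plim \<alpha>#}) -
    int (size {#\<alpha> \<in># proots (map_poly to_ac (snd (rat_quot \<phi>))). plim \<alpha>#})"
proof -
  let ?p = "map_poly to_ac (fst (rat_quot \<phi>))" and ?q = "map_poly to_ac (snd (rat_quot \<phi>))"
  let ?a = "fst (rat_quot (rat_to_ac \<phi>))" and ?b = "snd (rat_quot (rat_to_ac \<phi>))"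
  note nz = rat_quot_neq_0[OF assms] rat_quot_neq_0[OF rat_to_ac_neq_0[OF assms]]
  have pq: "?p \<noteq> 0" "?q \<noteq> 0" using nz by (simp_all add: map_poly_to_ac_eq_0_iff)
  have "proots ?a + proots ?q = proots ?p + proots ?b"
    using proots_mult[of ?a ?q] proots_mult[of ?p ?b] rat_quot_rat_to_ac[of \<phi>] nz pq by simp
  then have "size (filter_mset plim (proots ?a + proots ?q)) =
      size (filter_mset plim (proots ?p + proots ?b))" by simp
  then show ?thesis
    using degdom_eq[OF assms] by (simp add: rat_zeros_def rat_poles_def)
qed

text \<open>The factors at pseudo-limits contribute the multiple of the gauge; the remaining
  factors, with the leading coefficients, contribute the constant \<open>ga - gb\<close>.\<close>

theorem value_formula:
  assumes "\<phi> \<noteq> 0"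
  shows "\<exists>\<gamma>\<in>value_group v.
    (\<forall>\<^sub>F \<nu> in at_top. \<exists>d. \<delta> \<nu> = Fin d \<and>
      v (rat_eval \<phi> (s \<nu>)) = Fin (int_multiple (degdom j u s \<delta> \<phi>) d + \<gamma>)) \<and>
    (\<forall>\<beta>. plim \<beta> \<longrightarrow>
      u (rat_eval (rat_to_ac \<phi> / S_part \<phi> (limit_critical_points j u s \<delta> \<phi>)) \<beta>) = Fin (j \<gamma>))"
proof -
  define a where "a = fst (rat_quot (rat_to_ac \<phi>))"
  define b where "b = snd (rat_quot (rat_to_ac \<phi>))"
  define A where "A = filter_mset plim (proots a)"
  define B where "B = filter_mset plim (proots b)"
  define a' where "a' = smult (lead_coeff a) (linear_factors {#\<alpha> \<in># proots a. \<not> plim \<alpha>#})"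
  define b' where "b' = smult (lead_coeff b) (linear_factors {#\<alpha> \<in># proots b. \<not> plim \<alpha>#})"
  have ab0: "a \<noteq> 0" "b \<noteq> 0"
    using rat_quot_neq_0[OF rat_to_ac_neq_0[OF assms]] by (simp_all add: a_def b_def)
  have split: "f = linear_factors (filter_mset plim (proots f)) *
      smult (lead_coeff f) (linear_factors {#\<alpha> \<in># proots f. \<not> plim \<alpha>#})" if "f \<noteq> 0" for f
  proof -
    have "f = smult (lead_coeff f) (linear_factors (proots f))"
      by (rule poly_eq_linear_factors[OF that])
    also have "\<dots> = linear_factors (filter_mset plim (proots f)) *
        smult (lead_coeff f) (linear_factors {#\<alpha> \<in># proots f. \<not> plim \<alpha>#})"
      by (simp only: linear_factors_partition[of "proots f" plim] mult_smult_right)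
    finally show ?thesis .
  qed
  have a: "a = linear_factors A * a'" and b: "b = linear_factors B * b'"
    unfolding A_def B_def a'_def b'_def using split ab0 by blast+
  have nonlim: "\<exists>g. (\<forall>\<^sub>F \<nu> in at_top. u (poly f' (to_ac (s \<nu>))) = Fin g) \<and>
      (\<forall>\<beta>. plim \<beta> \<longrightarrow> u (poly f' \<beta>) = Fin g)"
    if f: "f \<noteq> 0" "f' = smult (lead_coeff f) (linear_factors {#\<alpha> \<in># proots f. \<not> plim \<alpha>#})" for f f'
  proof -
    obtain l where "u (lead_coeff f) = Fin l" using valuation_finite[OF u, of "lead_coeff f"] f by auto
    moreover obtain g where
      "\<forall>\<^sub>F \<nu> in at_top. u (poly (linear_factors {#\<alpha> \<in># proots f. \<not> plim \<alpha>#}) (to_ac (s \<nu>))) = Fin g"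
      "\<forall>\<beta>. plim \<beta> \<longrightarrow> u (poly (linear_factors {#\<alpha> \<in># proots f. \<not> plim \<alpha>#}) \<beta>) = Fin g"
      using u_linear_factors_not_lim[of "{#\<alpha> \<in># proots f. \<not> plim \<alpha>#}"] by auto
    ultimately show ?thesis
      by (intro exI[of _ "l + g"]) (auto simp: f(2) valuation_mult[OF u] elim: eventually_mono)
  qed
  obtain ga gb where
    ga: "\<forall>\<^sub>F \<nu> in at_top. u (poly a' (to_ac (s \<nu>))) = Fin ga" "\<And>\<beta>. plim \<beta> \<Longrightarrow> u (poly a' \<beta>) = Fin ga" and
    gb: "\<forall>\<^sub>F \<nu> in at_top. u (poly b' (to_ac (s \<nu>))) = Fin gb" "\<And>\<beta>. plim \<beta> \<Longrightarrow> u (poly b' \<beta>) = Fin gb"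
    using nonlim[OF ab0(1) a'_def] nonlim[OF ab0(2) b'_def] by metis
  have value_\<beta>: "u (rat_eval (rat_to_ac \<phi> / S_part \<phi> (limit_critical_points j u s \<delta> \<phi>)) \<beta>) = Fin (ga - gb)"
    if "plim \<beta>" for \<beta>
  proof -
    have "b' \<noteq> 0" using b ab0 by auto
    have \<phi>: "rat_to_ac \<phi> = Fract (linear_factors A * a') (linear_factors B * b')"
      using rat_quot(3)[of "rat_to_ac \<phi>"] a b by (simp flip: a_def b_def)
    have S: "S_part \<phi> (limit_critical_points j u s \<delta> \<phi>) = Fract (linear_factors A) (linear_factors B)"
      by (simp add: S_part_limit_critical_points[OF assms] A_def B_def a_def b_def rat_zeros_def rat_poles_def)
    have "rat_to_ac \<phi> / S_part \<phi> (limit_critical_points j u s \<delta> \<phi>) =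
        Fract (linear_factors A * a' * linear_factors B) (linear_factors B * b' * linear_factors A)"
      by (simp only: \<phi> S divide_fract)
    also have "\<dots> = Fract a' b'"
      using \<open>b' \<noteq> 0\<close> linear_factors_neq_0[of A] linear_factors_neq_0[of B] by (simp add: eq_fract)
    finally have eq: "rat_to_ac \<phi> / S_part \<phi> (limit_critical_points j u s \<delta> \<phi>) = Fract a' b'" .
    \<comment> \<open>The point \<open>\<beta>\<close> may itself be a critical point of
      \<open>\<phi>\<close>; with the S-part removed the denominator has finite value there.\<close>
    have "poly b' \<beta> \<noteq> 0" using gb(2)[OF that] valuation_eq_Fin_iff[OF u] by blast
    then show ?thesis
      unfolding eq using valuation_divide[OF u ga(2)[OF that] gb(2)[OF that]]
      by (simp add: rat_eval_Fract)
  qed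
  \<comment> \<open>The quotient lies in \<open>K\<close>, which is why the constant comes from a
    value of \<open>v\<close>.\<close>
  have "\<forall>\<^sub>F \<nu> in at_top. \<exists>c. c \<noteq> 0 \<and> v c = \<delta> \<nu> \<and>
      u (to_ac (rat_eval \<phi> (s \<nu>) / (c ^ size A / c ^ size B))) = Fin (ga - gb)"
  proof -
    have "\<forall>\<alpha>\<in>#A. plim \<alpha>" "\<forall>\<alpha>\<in>#B. plim \<alpha>" by (auto simp: A_def B_def)
    from ga(1) gb(1) gauge_attained this[THEN u_linear_factors_lim] show ?thesis
    proof eventually_elim
      case (elim \<nu>)
      let ?x = "to_ac (s \<nu>)"
      obtain c where c: "c \<noteq> 0" "v c = \<delta> \<nu>" using elim(3) by blast
      obtain d where d: "u (to_ac c) = Fin d" using valuation_finite[OF u] c(1) by (metis to_ac_eq_0_iff)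
      note power = valuation_power[OF u d]
      have LA: "u (poly (linear_factors A) ?x / to_ac c ^ size A) = Fin 0"
        and LB: "u (poly (linear_factors B) ?x / to_ac c ^ size B) = Fin 0"
        using elim(4,5) c(2) power valuation_divide[OF u _ power] by (simp_all del: to_ac_power)
      \<comment> \<open>Both factors of \<open>b\<close> have finite value at \<open>?x\<close>, so
        \<open>s \<nu>\<close> is not a pole and evaluation commutes with the embedding.\<close>
      have "poly b ?x \<noteq> 0"
        using LB elim(2) valuation_eq_Fin_iff[OF u] unfolding b by fastforce
      then have "to_ac (rat_eval \<phi> (s \<nu>)) = poly a ?x / poly b ?x"
        using to_ac_rat_eval[of \<phi> "s \<nu>"] by (simp add: a_def b_def rat_eval_def)
      then have "to_ac (rat_eval \<phi> (s \<nu>) / (c ^ size A / c ^ size B)) =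
          (poly (linear_factors A) ?x / to_ac c ^ size A * poly a' ?x) /
          (poly (linear_factors B) ?x / to_ac c ^ size B * poly b' ?x)"
        by (simp add: a b divide_inverse mult_ac)
      also have "u \<dots> = Fin (ga - gb)"
        by (rule valuation_divide[OF u])
          (simp_all only: valuation_mult[OF u] LA LB elim(1,2) plus_extended.simps add_0)
      finally show ?case using c by blast
    qed
  qed
  then obtain N where N: "\<And>\<nu>. N \<le> \<nu> \<Longrightarrow> \<exists>c. c \<noteq> 0 \<and> v c = \<delta> \<nu> \<and>
      u (to_ac (rat_eval \<phi> (s \<nu>) / (c ^ size A / c ^ size B))) = Fin (ga - gb)"
    unfolding eventually_at_top_linorder by blast
  \<comment> \<open>Any single index yields an element of \<open>K\<close> whose value is the
    constant; \<open>\<gamma>\<close> is its value under \<open>v\<close>.\<close>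
  obtain y where y: "u (to_ac y) = Fin (ga - gb)" using N[of N] by blast
  then obtain \<gamma> where \<gamma>: "v y = Fin \<gamma>" and j\<gamma>: "j \<gamma> = ga - gb"
    by (cases "v y") (auto simp: u_to_ac)
  have "\<exists>d. \<delta> \<nu> = Fin d \<and> v (rat_eval \<phi> (s \<nu>)) = Fin (int_multiple (degdom j u s \<delta> \<phi>) d + \<gamma>)"
    if \<nu>: "N \<le> \<nu>" for \<nu>
  proof -
    obtain c where c: "c \<noteq> 0" "v c = \<delta> \<nu>"
      "u (to_ac (rat_eval \<phi> (s \<nu>) / (c ^ size A / c ^ size B))) = Fin (ga - gb)" using N[OF \<nu>] by blast
    obtain d where d: "v c = Fin d" using valuation_finite[OF v c(1)] .
    let ?x = "rat_eval \<phi> (s \<nu>)" and ?y = "c ^ size A / c ^ size B"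
    have vy: "v ?y = Fin (int_multiple (degdom j u s \<delta> \<phi>) d)"
      using valuation_divide[OF v valuation_power[OF v d] valuation_power[OF v d]]
      by (simp add: degdom_eq[OF assms] int_multiple_diff A_def B_def a_def b_def rat_zeros_def rat_poles_def)
    \<comment> \<open>The quotient and \<open>y\<close> have equal values under \<open>u\<close>,
      hence under \<open>v\<close>, since \<open>map_extended j\<close> is injective on attained
      values.\<close>
    have "v (?x / ?y) = Fin \<gamma>" using c(3) y \<gamma> unfolding u_to_ac by (metis map_extended_j_eq)
    moreover have "?x = ?y * (?x / ?y)" using c(1) by simp
    ultimately have "v ?x = Fin (int_multiple (degdom j u s \<delta> \<phi>) d + \<gamma>)"
      using valuation_mult[OF v, of ?y "?x / ?y"] vy by simp
    then show ?thesis using c(2) d by metis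
  qed
  then have "\<forall>\<^sub>F \<nu> in at_top. \<exists>d. \<delta> \<nu> = Fin d \<and>
      v (rat_eval \<phi> (s \<nu>)) = Fin (int_multiple (degdom j u s \<delta> \<phi>) d + \<gamma>)"
    unfolding eventually_at_top_linorder by blast
  moreover have "\<gamma> \<in> value_group v" using \<gamma> by (auto simp: value_group_def)
  ultimately show ?thesis using value_\<beta> j\<gamma> by auto
qed

end

section \<open>Independence of the dominating degree from the extension\<close>

lemma degdom_unique:
  assumes 1: "pseudo_monotone_extension v s \<delta> j u" and 2: "pseudo_monotone_extension v s \<delta> j' u'"
    and "\<phi> \<noteq> 0"
  shows "degdom j u s \<delta> \<phi> = degdom j' u' s \<delta> \<phi>"
proof -
  have eq: "size {#\<alpha> \<in># proots (map_poly to_ac f). pseudo_limit j u s \<delta> \<alpha>#} =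
      size {#\<alpha> \<in># proots (map_poly to_ac f). pseudo_limit j' u' s \<delta> \<alpha>#}" if f: "f \<noteq> 0" for f
  proof -
    \<comment> \<open>One large index and one \<open>c\<close> serve both extensions, so both counts
      are the dominant index of the same polynomial over \<open>K\<close> with respect to
      \<open>v\<close>.\<close>
    obtain \<nu> c where c: "c \<noteq> 0" "v c = \<delta> \<nu>" and
      "\<forall>c. c \<noteq> 0 \<longrightarrow> v c = \<delta> \<nu> \<longrightarrow> dominant_index v (f \<circ>\<^sub>p [:s \<nu>, c:])
        (size {#\<alpha> \<in># proots (map_poly to_ac f). pseudo_limit j u s \<delta> \<alpha>#})"
      "\<forall>c. c \<noteq> 0 \<longrightarrow> v c = \<delta> \<nu> \<longrightarrow> dominant_index v (f \<circ>\<^sub>p [:s \<nu>, c:])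
        (size {#\<alpha> \<in># proots (map_poly to_ac f). pseudo_limit j' u' s \<delta> \<alpha>#})"
      using eventually_happens'[OF trivial_limit_at_top_linorder eventually_conj[OF
          pseudo_monotone_extension.gauge_attained[OF 1] eventually_conj[OF
            pseudo_monotone_extension.eventually_dominant_index[OF 1 f]
            pseudo_monotone_extension.eventually_dominant_index[OF 2 f]]]]
      by blast
    then show ?thesis using dominant_index_unique by blast
  qed
  \<comment> \<open>The numerator and the denominator over \<open>K\<close> are compared
    separately.\<close>
  show ?thesis
    using eq rat_quot_neq_0[OF \<open>\<phi> \<noteq> 0\<close>]
    by (simp add: pseudo_monotone_extension.degdom_eq_base[OF 1]
        pseudo_monotone_extension.degdom_eq_base[OF 2] \<open>\<phi> \<noteq> 0\<close>)
qed

theorem proposition3p2: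
  fixes V :: "'k::field set"
    and v :: "'k \<Rightarrow> 'g::linordered_ab_group_add extended"
    and s :: "'i::{wellorder, no_top} \<Rightarrow> 'k"
    and \<delta> :: "'i \<Rightarrow> 'g extended"
    and \<phi> :: "'k poly fract"
    and j :: "'g \<Rightarrow> 'h::linordered_ab_group_add"
    and u :: "'k alg_closure \<Rightarrow> 'h extended"
    and j' :: "'g \<Rightarrow> 'h'::linordered_ab_group_add"
    and u' :: "'k alg_closure \<Rightarrow> 'h' extended"
  assumes "valuation_domain V" and "valuation_of V v"
    and "pseudo_monotone v s" and "is_gauge v s \<delta>"
    and "\<phi> \<noteq> 0"
    and "extends_valuation j v u"
  shows "(\<exists>\<gamma>\<in>value_group v. \<exists>\<nu>\<^sub>0.
           (\<forall>\<nu>\<ge>\<nu>\<^sub>0. \<exists>d. \<delta> \<nu> = Fin d \<and>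
              v (rat_eval \<phi> (s \<nu>)) = Fin (int_multiple (degdom j u s \<delta> \<phi>) d + \<gamma>)) \<and>
           (\<forall>\<beta>. pseudo_limit j u s \<delta> \<beta> \<longrightarrow>
              u (rat_eval (rat_to_ac \<phi> / S_part \<phi> (limit_critical_points j u s \<delta> \<phi>)) \<beta>) = Fin (j \<gamma>))) \<and>
         (extends_valuation j' v u' \<longrightarrow> degdom j u s \<delta> \<phi> = degdom j' u' s \<delta> \<phi>)"
proof
  have v: "valuation v" using assms(2) by (simp add: valuation_of_def)
  interpret pseudo_monotone_extension v s \<delta> j u
    using v assms by unfold_locales
  obtain \<gamma> \<nu>0 where "\<gamma> \<in> value_group v"
    "\<forall>\<nu>\<ge>\<nu>0. \<exists>d. \<delta> \<nu> = Fin d \<and>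
      v (rat_eval \<phi> (s \<nu>)) = Fin (int_multiple (degdom j u s \<delta> \<phi>) d + \<gamma>)"
    "\<forall>\<beta>. plim \<beta> \<longrightarrow>
      u (rat_eval (rat_to_ac \<phi> / S_part \<phi> (limit_critical_points j u s \<delta> \<phi>)) \<beta>) = Fin (j \<gamma>)"
    using value_formula[OF assms(5)] unfolding eventually_at_top_linorder by blast
  then show "\<exists>\<gamma>\<in>value_group v. \<exists>\<nu>\<^sub>0.
           (\<forall>\<nu>\<ge>\<nu>\<^sub>0. \<exists>d. \<delta> \<nu> = Fin d \<and>
              v (rat_eval \<phi> (s \<nu>)) = Fin (int_multiple (degdom j u s \<delta> \<phi>) d + \<gamma>)) \<and>
           (\<forall>\<beta>. pseudo_limit j u s \<delta> \<beta> \<longrightarrow>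
              u (rat_eval (rat_to_ac \<phi> / S_part \<phi> (limit_critical_points j u s \<delta> \<phi>)) \<beta>) = Fin (j \<gamma>))"
    by blast
  show "extends_valuation j' v u' \<longrightarrow> degdom j u s \<delta> \<phi> = degdom j' u' s \<delta> \<phi>"
  proof
    assume "extends_valuation j' v u'"
    then have "pseudo_monotone_extension v s \<delta> j' u'"
      using v assms(3,4) by unfold_locales
    then show "degdom j u s \<delta> \<phi> = degdom j' u' s \<delta> \<phi>"
      by (rule degdom_unique[OF pseudo_monotone_extension_axioms _ assms(5)])
  qed
qed

end
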